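(* For a lattice homomorphism $f:L\to M$ define $\mathrm{rk}(f)=\ell(L)-\ell(\mathrm{Ker}(f))$, where $\ell(L)=\ln(\rho(L))$. Then $\mathrm{rk}$ is a left-exact rank on the category $\mathbf{Lat}$ of lattices. That is: $\mathrm{rk}$ takes nonnegative real values; for all lattice homomorphisms $f:L\to M$ and $g:M\to N$ one has $\mathrm{rk}(g\circ f)\le\mathrm{rk}(f)$ and $\mathrm{rk}(g\circ f)\le\mathrm{rk}(g)$; and for every lattice homomorphism $f:L\to M$ one has $\mathrm{rk}(f)=\mathrm{rk}(\mathrm{id}_L)-\mathrm{rk}(\mathrm{id}_{\mathrm{Ker}(f)})$.
   Context: A lattice is a subgroup $L$ of a finite-dimensional real inner product space that is generated by a linearly independent set of vectors (equivalently, is discrete). A lattice homomorphism $f:L\to M$ is a group homomorphism with $\|f(x)\|\le\|x\|$ for all $x\in L$. $\mathbf{Lat}$ is the category of lattices and lattice homomorphisms. The kernel of $f:L\to M$ is $\mathrm{Ker}(f)=\{x\in L: f(x)=0\}$, a lattice with the inner product inherited from $L$. For an element $x$ of an inner product space, $\rho(x)=e^{-\pi\|x\|^2}$; for a subset $S$, $\rho(S)=\sum_{x\in S}\rho(x)$. *)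

theory Defs
  imports
    "HOL-Analysis.Analysis"
    "HOL-Computational_Algebra.Group_Closure"
begin

definition is_lattice :: "'a::euclidean_space set \<Rightarrow> bool" where
  "is_lattice L \<longleftrightarrow> (\<exists>B. independent B \<and> L = group_closure B)"

text \<open>
  Lattices are sets in an ambient Euclidean space, so a homomorphism \<open>L \<rightarrow> M\<close> is represented by a
  total function on the ambient space of which only the values on \<open>L\<close> matter.
\<close>

definition lattice_hom ::
    "'a::euclidean_space set \<Rightarrow> 'b::euclidean_space set \<Rightarrow> ('a \<Rightarrow> 'b) \<Rightarrow> bool" where
  "lattice_hom L M f \<longleftrightarrow>
     is_lattice L \<and> is_lattice M \<and>
     (\<forall>x\<in>L. f x \<in> M) \<and>
     (\<forall>x\<in>L. \<forall>y\<in>L. f (x + y) = f x + f y) \<and>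
     (\<forall>x\<in>L. norm (f x) \<le> norm x)"

definition lattice_ker :: "'a::euclidean_space set \<Rightarrow> ('a \<Rightarrow> 'b::euclidean_space) \<Rightarrow> 'a set" where
  "lattice_ker L f = {x \<in> L. f x = 0}"

definition gauss :: "'a::euclidean_space \<Rightarrow> real" where
  "gauss x = exp (- pi * (norm x)\<^sup>2)"

text \<open>
  \<open>infsum\<close> is \<open>0\<close> on non-summable families, so \<open>rho S\<close> is the intended sum only when \<open>gauss\<close> is
  summable on \<open>S\<close>.
\<close>

definition rho :: "'a::euclidean_space set \<Rightarrow> real" where
  "rho S = (\<Sum>\<^sub>\<infinity>x\<in>S. gauss x)"

definition ell :: "'a::euclidean_space set \<Rightarrow> real" where
  "ell L = ln (rho L)"

text \<open>
  The rank of \<open>f : L \<rightarrow> M\<close>; the codomain \<open>M\<close> does not enter the formula.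
\<close>

definition rk :: "'a::euclidean_space set \<Rightarrow> ('a \<Rightarrow> 'b::euclidean_space) \<Rightarrow> real" where
  "rk L f = ell L - ell (lattice_ker L f)"

end

theory Submission
  imports Defs
begin

text \<open>
  The inequality between the ranks of \<open>g \<circ> f\<close> and \<open>g\<close> reads
  \<open>\<rho>(L) \<rho>(Ker g) \<le> \<rho>(M) \<rho>(f\<^sup>-\<^sup>1(Ker g))\<close>. It is an instance of the supermodularity
  \<open>\<rho>(H) \<rho>(K) \<le> \<rho>(H + K) \<rho>(H \<inter> K)\<close> of Gaussian masses of subgroups (Regev and
  Stephens-Davidowitz), applied to \<open>M \<times> L\<close> with the quadratic form \<open>|m|\<^sup>2 + |x|\<^sup>2 - |f x|\<^sup>2\<close>,
  to the graph of \<open>f\<close>, which this form makes isometric to \<open>L\<close>, and to \<open>Ker g \<times> L\<close>. The form is only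
  semidefinite, so it is perturbed to \<open>|m|\<^sup>2 + (1 + e) |x|\<^sup>2 - |f x|\<^sup>2\<close> and \<open>e\<close> tends to \<open>0\<close>.

  Supermodularity follows, by summation over cosets, from
  \<open>2 \<rho>(A + x) \<rho>(A + y) \<le> \<rho>(A) (\<rho>(A + x + y) + \<rho>(A + x - y))\<close>; this in turn comes from rotating
  \<open>A \<times> A\<close> by \<open>(u, v) \<mapsto> (u + v, u - v)\<close>, splitting the image into cosets of \<open>2A \<times> 2A\<close>, and
  applying \<open>2ab \<le> a\<^sup>2 + b\<^sup>2\<close> on each of them.
\<close>

subsection \<open>Sums over count spaces\<close>

text \<open>Tonelli for counting measure on the full types, carried over to sets by indicators. It
  holds for index sets of any cardinality.\<close>

lemma nn_integral_count_space_Times: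
  "(\<integral>\<^sup>+x. \<integral>\<^sup>+y. f x y
      \<partial>count_space B \<partial>count_space A) = (\<integral>\<^sup>+(x, y). f x y \<partial>count_space (A \<times> B))"
proof -
  have "(\<integral>\<^sup>+x. \<integral>\<^sup>+y. f x y \<partial>count_space B \<partial>count_space A)
      = (\<integral>\<^sup>+x. (\<integral>\<^sup>+y. f x y * indicator B y
          \<partial>count_space UNIV) * indicator A x \<partial>count_space UNIV)"
    by (simp add: nn_integral_count_space_indicator[of A] nn_integral_count_space_indicator[of B])
  also have "\<dots> = (\<integral>\<^sup>+x. \<integral>\<^sup>+y. (\<lambda>(x, y). f x y * indicator (A \<times> B) (x, y)) (x, y)
      \<partial>count_space UNIV \<partial>count_space UNIV)"
    by (intro nn_integral_cong) (simp add: indicator_times mult_ac flip: nn_integral_cmult)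
  also have "\<dots> = (\<integral>\<^sup>+(x, y). f x y \<partial>count_space (A \<times> B))"
    unfolding nn_integral_fst_count_space
    by (simp add: nn_integral_count_space_indicator[of "A \<times> B"] case_prod_unfold)
  finally show ?thesis .
qed

lemma nn_integral_count_space_product:
  fixes f :: "'a \<Rightarrow> ennreal" and g :: "'b \<Rightarrow> ennreal"
  shows "(\<integral>\<^sup>+(x, y). f x * g y \<partial>count_space (A \<times> B))
    = (\<integral>\<^sup>+x. f x \<partial>count_space A) * (\<integral>\<^sup>+y. g y \<partial>count_space B)"
  by (simp add: nn_integral_count_space_Times[symmetric] nn_integral_cmult nn_integral_multc)

lemma nn_integral_count_space_mono_set:
  assumes "A \<subseteq> B"
  shows "(\<integral>\<^sup>+x. f x \<partial>count_space A) \<le> (\<integral>\<^sup>+x. f x \<partial>count_space B)"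
  using assms
  by (simp add: nn_integral_count_space_indicator[of A] nn_integral_count_space_indicator[of B])
     (intro nn_integral_mono mult_left_mono, auto simp: indicator_def)

lemma ennreal_two_mult_le_squares:
  fixes a b :: ennreal
  shows "2 * (a * b) \<le> a * a + b * b"
proof (cases a)
  case a: (real r)
  show ?thesis
  proof (cases b)
    case b: (real s)
    have "2 * (r * s) \<le> r * r + s * s"
      using sum_squares_bound[of r s] by (simp add: power2_eq_square)
    then have "ennreal (2 * (r * s)) \<le> ennreal (r * r + s * s)"
      by (rule ennreal_leI)
    then show ?thesis
      using a b by (simp add: ennreal_mult' ennreal_plus)
  qed (simp add: ennreal_mult_top)
qed simp

subsection \<open>Subgroups and transversals\<close>

text \<open>A predicate on subsets of any abelian group, so that one notion covers lattices,
  products of lattices and sets of integer coefficients.\<close>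

definition add_subgroup :: "'a::ab_group_add set \<Rightarrow> bool" where
  "add_subgroup A \<longleftrightarrow> 0 \<in> A \<and> (\<forall>x\<in>A. \<forall>y\<in>A. x - y \<in> A)"

lemma add_subgroup_zero: "add_subgroup A \<Longrightarrow> 0 \<in> A"
  and add_subgroup_diff: "add_subgroup A \<Longrightarrow> x \<in> A \<Longrightarrow> y \<in> A \<Longrightarrow> x - y \<in> A"
  by (simp_all add: add_subgroup_def)

lemma add_subgroup_minus: "add_subgroup A \<Longrightarrow> x \<in> A \<Longrightarrow> - x \<in> A"
  using add_subgroup_diff[of A 0 x] by (simp add: add_subgroup_zero)

lemma add_subgroup_add: "add_subgroup A \<Longrightarrow> x \<in> A \<Longrightarrow> y \<in> A \<Longrightarrow> x + y \<in> A"
  using add_subgroup_diff[of A x "- y"] by (simp add: add_subgroup_minus)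

lemmas add_subgroup_closed =
  add_subgroup_zero add_subgroup_diff add_subgroup_minus add_subgroup_add

lemma add_subgroup_Int: "add_subgroup A \<Longrightarrow> add_subgroup B \<Longrightarrow> add_subgroup (A \<inter> B)"
  by (auto simp: add_subgroup_def)

text \<open>The third property says that representatives are distinct modulo \<open>A\<close>. It is
  stated separately because later arguments combine \<open>T\<close> with elements of sets other
  than \<open>A\<close>, where the bijection alone does not apply.\<close>

lemma add_subgroup_transversal:
  assumes A: "add_subgroup A" and H: "add_subgroup H" and AH: "A \<subseteq> H"
  obtains T where "T \<subseteq> H" "bij_betw (\<lambda>(t, a). t + a) (T \<times> A) H"
    "\<And>t t'. t \<in> T \<Longrightarrow> t' \<in> T \<Longrightarrow> t - t' \<in> A \<Longrightarrow> t = t'"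
proof -
  \<comment> \<open>The predicate under \<open>SOME\<close> depends on \<open>x\<close> only through
    its coset modulo \<open>A\<close>, so \<open>r\<close> is constant on cosets and its image of
    \<open>H\<close> is a transversal.\<close>
  define r where "r x = (SOME y. y \<in> H \<and> y - x \<in> A)" for x
  have r: "r x \<in> H \<and> r x - x \<in> A" if "x \<in> H" for x
    unfolding r_def by (rule someI[of _ x]) (use that A in \<open>auto intro: add_subgroup_closed\<close>)
  have r_eq: "r x = r y" if "x - y \<in> A" for x y
  proof -
    have "(z - x \<in> A) = (z - y \<in> A)" for z
      using add_subgroup_add[OF A that, of "z - x"] add_subgroup_diff[OF A _ that, of "z - y"]
      by (auto simp: algebra_simps)
    then show ?thesis by (simp add: r_def)
  qed
  have uniq: "t = t'" if t: "t \<in> r ` H" "t' \<in> r ` H" "t - t' \<in> A" for t t'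
  proof -
    obtain x y where xy: "x \<in> H" "t = r x" "y \<in> H" "t' = r y" using t by auto
    have "x - y = (t - t') - (r x - x) + (r y - y)" using xy by simp
    moreover have "r x - x \<in> A" "r y - y \<in> A" using r xy by auto
    ultimately have "x - y \<in> A" using t(3) A by (metis add_subgroup_add add_subgroup_diff)
    then show ?thesis using r_eq xy by simp
  qed
  have "bij_betw (\<lambda>(t, a). t + a) (r ` H \<times> A) H"
  proof (rule bij_betwI')
    fix p q assume p: "p \<in> r ` H \<times> A" and q: "q \<in> r ` H \<times> A"
    show "((case p of (t, a) \<Rightarrow> t + a) = (case q of (t, a) \<Rightarrow> t + a)) = (p = q)"
    proof
      assume eq: "(case p of (t, a) \<Rightarrow> t + a) = (case q of (t, a) \<Rightarrow> t + a)"
      then have "fst p - fst q = snd q - snd p" by (simp add: case_prod_unfold algebra_simps)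
      then have "fst p - fst q \<in> A" using p q A by (auto intro: add_subgroup_closed)
      then have "fst p = fst q" using uniq p q by (auto simp: mem_Times_iff)
      with eq show "p = q" by (auto simp: case_prod_unfold prod_eq_iff)
    qed simp
  next
    fix p assume "p \<in> r ` H \<times> A"
    then show "(case p of (t, a) \<Rightarrow> t + a) \<in> H"
      using r AH H by (auto intro!: add_subgroup_closed)
  next
    fix h assume h: "h \<in> H"
    have "h = r h + - (r h - h)" by simp
    moreover have "- (r h - h) \<in> A" using r[OF h] A by (blast intro: add_subgroup_minus)
    ultimately show "\<exists>p\<in>r ` H \<times> A. h = (case p of (t, a) \<Rightarrow> t + a)"
      using h by (intro bexI[of _ "(r h, - (r h - h))"]) auto
  qed
  then show ?thesis using that[of "r ` H"] r uniq by auto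
qed

subsection \<open>Gaussian masses of subgroups\<close>

text \<open>
  The values lie in \<open>ennreal\<close> so that rearranging the sums needs no summability hypotheses.
\<close>

definition theta :: "('a \<Rightarrow> real) \<Rightarrow> 'a::ab_group_add set \<Rightarrow> 'a \<Rightarrow> ennreal" where
  "theta Q A z = (\<integral>\<^sup>+u. ennreal (exp (- Q (u + z))) \<partial>count_space A)"

text \<open>The trait of a quadratic form that the rotation argument uses. It is relative to
  \<open>G\<close> because a form built from a lattice homomorphism is known to obey it only where
  that map is additive.\<close>

definition parallelogram_on :: "'a::ab_group_add set \<Rightarrow> ('a \<Rightarrow> real) \<Rightarrow> bool" where
  "parallelogram_on G Q \<longleftrightarrow> (\<forall>x\<in>G. \<forall>y\<in>G. Q (x + y) + Q (x - y) = 2 * Q x + 2 * Q y)"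

lemma parallelogram_on_minus:
  assumes "add_subgroup G" "parallelogram_on G Q" "x \<in> G"
  shows "Q (- x) = Q x"
proof -
  have "0 \<in> G" using assms(1) by (rule add_subgroup_zero)
  have "Q (0 + 0) + Q (0 - 0) = 2 * Q 0 + 2 * Q 0" "Q (0 + x) + Q (0 - x) = 2 * Q 0 + 2 * Q x"
    using assms(2,3) \<open>0 \<in> G\<close> unfolding parallelogram_on_def by blast+
  then show ?thesis by simp
qed

text \<open>\<open>H\<close> may be any set tiled by the translates \<open>t + A\<close>; besides
  subgroups it is later a union of cosets indexed by a transversal.\<close>

lemma theta_coset_sum:
  assumes bij: "bij_betw (\<lambda>(t, a). t + a) (T \<times> A) H"
  shows "(\<integral>\<^sup>+t. theta Q A (t + z) \<partial>count_space T) = theta Q H z"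
proof -
  have "(\<integral>\<^sup>+t. theta Q A (t + z) \<partial>count_space T)
      = (\<integral>\<^sup>+p. ennreal (exp (- Q ((case p of (t, a) \<Rightarrow> t + a) + z)))
          \<partial>count_space (T \<times> A))"
    unfolding theta_def nn_integral_count_space_Times
    by (intro nn_integral_cong) (auto simp: algebra_simps)
  also have "\<dots> = theta Q H z"
    unfolding theta_def by (rule nn_integral_bij_count_space[OF bij])
  finally show ?thesis .
qed

lemma theta_minus_arg:
  assumes G: "add_subgroup G" and Q: "parallelogram_on G Q"
    and A: "add_subgroup A" "A \<subseteq> G" and z: "z \<in> G"
  shows "theta Q A (- z) = theta Q A z"
proof -
  have bij: "bij_betw uminus A A"
    by (rule bij_betwI[of _ _ _ uminus]) (use A in \<open>auto intro: add_subgroup_minus\<close>)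
  have "theta Q A z = (\<integral>\<^sup>+u. ennreal (exp (- Q (- u + z))) \<partial>count_space A)"
    unfolding theta_def by (rule nn_integral_bij_count_space[OF bij, symmetric])
  also have "\<dots> = theta Q A (- z)"
    unfolding theta_def
  proof (intro nn_integral_cong)
    fix u assume "u \<in> space (count_space A)"
    then have "u + - z \<in> G" using A z G by (auto intro!: add_subgroup_closed)
    from parallelogram_on_minus[OF G Q this]
    show "ennreal (exp (- Q (- u + z))) = ennreal (exp (- Q (u + - z)))" by simp
  qed
  finally show ?thesis by simp
qed

text \<open>The image of \<open>A \<times> A\<close> under
  \<open>(u, v) \<mapsto> (u + v, u - v)\<close> consists of the pairs in \<open>A\<close> that are
  congruent modulo \<open>D\<close>, the doubles of \<open>A\<close>. A pair in the class of
  \<open>t\<close> has the form \<open>(t + 2a, t + 2b)\<close> with independent \<open>a\<close>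
  and \<open>b\<close>, so the sum over each class factors into two values of
  \<open>P t\<close>.\<close>

lemma theta_mult_rotate:
  fixes Q :: "'a::real_vector \<Rightarrow> real"
  assumes Q: "parallelogram_on G Q" and G: "add_subgroup G"
    and A: "add_subgroup A" and AG: "A \<subseteq> G" and x: "x \<in> G" and y: "y \<in> G"
    and TA: "T \<subseteq> A" and bij: "bij_betw (\<lambda>(t, a). t + a) (T \<times> D) A"
    and dbl: "D = (\<lambda>a. a + a) ` A"
    and uniq: "\<And>t t'. t \<in> T \<Longrightarrow> t' \<in> T \<Longrightarrow> t - t' \<in> D \<Longrightarrow> t = t'"
  defines "P t z \<equiv> \<integral>\<^sup>+a. ennreal (exp (- Q (t + (a + a) + z) / 2)) \<partial>count_space A"
  shows "theta Q A x * theta Q A y = (\<integral>\<^sup>+t. P t (x + y) * P t (x - y) \<partial>count_space T)"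
proof -
  define E where "E z = ennreal (exp (- Q z / 2))" for z
  \<comment> \<open>This is the inverse rotation in the parameters \<open>t\<close>,
    \<open>a\<close>, \<open>b\<close>: its components have sum \<open>t + 2a\<close> and difference
    \<open>t + 2b\<close>.\<close>
  define \<phi> where "\<phi> = (\<lambda>(t, a, b). (t + a + b, a - b :: 'a))"
  \<comment> \<open>Absence of 2-torsion makes \<open>a\<close> recoverable from its double; a real
    vector space as ambient group provides this.\<close>
  have half: "a = b" if "a + a = b + b" for a b :: 'a
    using that by (simp flip: scaleR_2)
  have \<phi>: "bij_betw \<phi> (T \<times> A \<times> A) (A \<times> A)"
    unfolding bij_betw_def
  proof
    show "inj_on \<phi> (T \<times> A \<times> A)"
    proof (rule inj_onI)
      fix p q assume p: "p \<in> T \<times> A \<times> A" and q: "q \<in> T \<times> A \<times> A" and eq: "\<phi> p = \<phi> q"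
      obtain t a b t' a' b' where pq: "p = (t, a, b)" "q = (t', a', b')"
        by (metis prod_cases3)
      have e: "t + a + b = t' + a' + b'" "a - b = a' - b'"
        using eq by (auto simp: pq \<phi>_def)
      have e2: "t + (a + a) = t' + (a' + a')"
        using arg_cong2[OF e, of "(+)"] by (simp add: algebra_simps)
      then have "t - t' = (a' - a) + (a' - a)" by (simp add: algebra_simps)
      moreover have "a' - a \<in> A" using p q A by (auto simp: pq intro: add_subgroup_diff)
      ultimately have "t - t' \<in> D" using dbl by auto
      then have "t = t'" using uniq p q by (auto simp: pq)
      moreover have "a = a'" using half[of a a'] e2 \<open>t = t'\<close> by simp
      ultimately show "p = q" using e by (simp add: pq)
    qed
    have "p \<in> \<phi> ` (T \<times> A \<times> A)" if p: "p \<in> A \<times> A" for p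
    proof -
      obtain u v where p: "p = (u, v)" "u \<in> A" "v \<in> A" using p by auto
      then have "u + v \<in> (\<lambda>(t, a). t + a) ` (T \<times> D)"
        by (simp add: bij_betw_imp_surj_on[OF bij] A add_subgroup_add)
      then obtain t a where ta: "t \<in> T" "a \<in> A" "u + v = t + (a + a)"
        unfolding dbl by (elim imageE SigmaE) auto
      have "\<phi> (t, a, a - v) = (u, v)"
        using ta by (simp add: \<phi>_def algebra_simps)
      moreover have "a - v \<in> A" using A ta p by (blast intro: add_subgroup_diff)
      ultimately show ?thesis using ta(1,2) unfolding p(1) by (metis SigmaI imageI)
    qed
    moreover have "\<phi> ` (T \<times> A \<times> A) \<subseteq> A \<times> A"
    proof (rule image_subsetI)
      fix p assume "p \<in> T \<times> A \<times> A"
      then obtain t a b where "p = (t, a, b)" "t \<in> A" "a \<in> A" "b \<in> A" using TA by blast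
      then show "\<phi> p \<in> A \<times> A"
        by (simp add: \<phi>_def A add_subgroup_add add_subgroup_diff)
    qed
    ultimately show "\<phi> ` (T \<times> A \<times> A) = A \<times> A" by blast
  qed
  have "theta Q A x * theta Q A y
      = (\<integral>\<^sup>+p. (case p of (u, v) \<Rightarrow> ennreal (exp (- Q (u + x))) * ennreal (exp (- Q (v + y))))
          \<partial>count_space (A \<times> A))"
    by (simp add: theta_def nn_integral_count_space_product)
  also have "\<dots> = (\<integral>\<^sup>+p. (case p of (u, v) \<Rightarrow> E (u + v + (x + y)) * E (u - v + (x - y)))
      \<partial>count_space (A \<times> A))"
  proof (intro nn_integral_cong)
    fix p assume "p \<in> space (count_space (A \<times> A))"
    then obtain u v where p: "p = (u, v)" "u \<in> A" "v \<in> A" by auto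
    then have "u + x \<in> G" "v + y \<in> G" using G AG x y by (auto intro!: add_subgroup_closed)
    \<comment> \<open>The rotation doubles the total value of \<open>Q\<close>, which is why
      \<open>E\<close> and \<open>P\<close> carry the factor 1/2.\<close>
    then have "Q ((u + x) + (v + y)) + Q ((u + x) - (v + y)) = 2 * Q (u + x) + 2 * Q (v + y)"
      using Q by (simp add: parallelogram_on_def)
    then have "Q (u + v + (x + y)) / 2 + Q (u - v + (x - y)) / 2 = Q (u + x) + Q (v + y)"
      by (simp add: algebra_simps)
    then have "exp (- Q (u + x)) * exp (- Q (v + y))
        = exp (- Q (u + v + (x + y)) / 2) * exp (- Q (u - v + (x - y)) / 2)"
      unfolding exp_add[symmetric] by simp
    then show "(case p of (u, v) \<Rightarrow> ennreal (exp (- Q (u + x))) * ennreal (exp (- Q (v + y))))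
        = (case p of (u, v) \<Rightarrow> E (u + v + (x + y)) * E (u - v + (x - y)))"
      by (simp only: p prod.case E_def ennreal_mult'[symmetric] exp_ge_zero)
  qed
  also have "\<dots> = (\<integral>\<^sup>+p. (case \<phi> p of (u, v) \<Rightarrow> E (u + v + (x + y)) * E (u - v + (x - y)))
      \<partial>count_space (T \<times> A \<times> A))"
    by (rule nn_integral_bij_count_space[OF \<phi>, symmetric])
  also have "\<dots> = (\<integral>\<^sup>+(t, a, b). E (t + (a + a) + (x + y)) * E (t + (b + b) + (x - y))
      \<partial>count_space (T \<times> A \<times> A))"
    by (intro nn_integral_cong) (auto simp: \<phi>_def algebra_simps)
  also have "\<dots> = (\<integral>\<^sup>+t. \<integral>\<^sup>+(a, b). E (t + (a + a) + (x + y)) * E (t + (b + b) + (x - y))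
      \<partial>count_space (A \<times> A) \<partial>count_space T)"
    by (simp add: nn_integral_count_space_Times)
  also have "\<dots> = (\<integral>\<^sup>+t. P t (x + y) * P t (x - y) \<partial>count_space T)"
    by (simp add: nn_integral_count_space_product P_def E_def)
  finally show ?thesis .
qed

text \<open>Rotation turns the left side into a sum of mixed products
  \<open>P t (x + y) * P t (x - y)\<close> and the right side into the matching sum of squares, so
  the inequality holds term by term.\<close>

lemma theta_mult_le:
  fixes Q :: "'a::real_vector \<Rightarrow> real"
  assumes G: "add_subgroup G" and Q: "parallelogram_on G Q"
    and A: "add_subgroup A" and AG: "A \<subseteq> G" and x: "x \<in> G" and y: "y \<in> G"
  shows "2 * (theta Q A x * theta Q A y) \<le> theta Q A 0 * (theta Q A (x + y) + theta Q A (x - y))"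
proof -
  define D where "D = (\<lambda>a. a + a) ` A"
  have "D \<subseteq> A"
    using add_subgroup_add[OF A] by (auto simp: D_def)
  moreover have "add_subgroup D"
    unfolding add_subgroup_def
  proof (intro conjI ballI)
    show "0 \<in> D" unfolding D_def using add_subgroup_zero[OF A] by (rule rev_image_eqI) simp
    fix x y assume "x \<in> D" "y \<in> D"
    then obtain a b where "a \<in> A" "b \<in> A" "x = a + a" "y = b + b" by (auto simp: D_def)
    then show "x - y \<in> D" unfolding D_def
      by (intro rev_image_eqI[of "a - b"]) (auto simp: A add_subgroup_diff)
  qed
  ultimately obtain T where T: "T \<subseteq> A" "bij_betw (\<lambda>(t, a). t + a) (T \<times> D) A"
    "\<And>t t'. t \<in> T \<Longrightarrow> t' \<in> T \<Longrightarrow> t - t' \<in> D \<Longrightarrow> t = t'"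
    using add_subgroup_transversal[OF _ A, of D] by metis
  define P where "P t z = (\<integral>\<^sup>+a. ennreal (exp (- Q (t + (a + a) + z) / 2)) \<partial>count_space A)" for t z
  note rot = theta_mult_rotate[OF Q G A AG _ _ T(1,2) D_def T(3), folded P_def]
  \<comment> \<open>With second argument 0 the sum and the difference agree, and the rotated product
    becomes a square.\<close>
  have sq: "theta Q A 0 * theta Q A z = (\<integral>\<^sup>+t. P t z * P t z \<partial>count_space T)" if "z \<in> G" for z
    using rot[OF that add_subgroup_zero[OF G]] by (simp add: mult.commute)
  have "2 * (theta Q A x * theta Q A y) = (\<integral>\<^sup>+t. 2 * (P t (x + y) * P t (x - y)) \<partial>count_space T)"
    by (simp add: rot[OF x y] nn_integral_cmult)
  also have "\<dots> \<le> (\<integral>\<^sup>+t. P t (x + y) * P t (x + y) + P t (x - y) * P t (x - y)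
      \<partial>count_space T)"
    by (intro nn_integral_mono ennreal_two_mult_le_squares)
  also have "\<dots> = theta Q A 0 * (theta Q A (x + y) + theta Q A (x - y))"
    using G x y by (simp add: nn_integral_add sq distrib_left add_subgroup_add add_subgroup_diff)
  finally show ?thesis .
qed

text \<open>Put \<open>y = t\<close> in \<open>theta_mult_le\<close> and sum over a transversal
  \<open>t\<close> of \<open>A\<close> in \<open>H\<close>. The coset masses of \<open>A\<close> add
  up to masses of \<open>H\<close>, and evenness merges the contributions of \<open>x\<close> and
  \<open>- x\<close>.\<close>

lemma theta_ratio_mono:
  fixes Q :: "'a::real_vector \<Rightarrow> real"
  assumes G: "add_subgroup G" and Q: "parallelogram_on G Q"
    and A: "add_subgroup A" and H: "add_subgroup H" and AH: "A \<subseteq> H" and HG: "H \<subseteq> G" and x: "x \<in> G"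
  shows "theta Q A x * theta Q H 0 \<le> theta Q A 0 * theta Q H x"
proof -
  obtain T where T: "T \<subseteq> H" "bij_betw (\<lambda>(t, a). t + a) (T \<times> A) H"
    using add_subgroup_transversal[OF A H AH] by metis
  have TG: "t \<in> G" if "t \<in> T" for t using that T HG by blast
  have AG: "A \<subseteq> G" using AH HG by simp
  \<comment> \<open>In \<open>x - t\<close> the representative has the wrong sign for
    \<open>theta_coset_sum\<close>; reflection moves it to the coset of
    \<open>t + - x\<close>.\<close>
  have reflect: "theta Q A (x - t) = theta Q A (t + - x)" if "t \<in> T" for t
    using theta_minus_arg[OF G Q A AG, of "x - t"] x TG[OF that] G by (simp add: add_subgroup_diff)
  have "2 * (theta Q A x * theta Q H 0) = (\<integral>\<^sup>+t. 2 * (theta Q A x * theta Q A t) \<partial>count_space T)"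
    using theta_coset_sum[OF T(2), of Q 0] by (simp add: nn_integral_cmult)
  also have "\<dots> \<le> (\<integral>\<^sup>+t. theta Q A 0 * (theta Q A (x + t) + theta Q A (x - t))
      \<partial>count_space T)"
    by (intro nn_integral_mono theta_mult_le[OF G Q A AG x]) (simp add: TG)
  also have "\<dots> = (\<integral>\<^sup>+t. theta Q A 0 * (theta Q A (t + x) + theta Q A (t + - x))
      \<partial>count_space T)"
    by (intro nn_integral_cong) (simp add: reflect add.commute)
  also have "\<dots> = theta Q A 0 * (theta Q H x + theta Q H (- x))"
    by (simp only: nn_integral_cmult borel_measurable_count_space nn_integral_add theta_coset_sum[OF T(2)])
  also have "theta Q H (- x) = theta Q H x"
    by (rule theta_minus_arg[OF G Q H HG x])
  finally have "2 * (theta Q A x * theta Q H 0) \<le> 2 * (theta Q A 0 * theta Q H x)"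
    by (simp add: mult_2 distrib_left)
  then show ?thesis
    by (subst (asm) ennreal_mult_le_mult_iff) auto
qed

text \<open>Decompose \<open>H\<close> into cosets \<open>t + A\<close> of
  \<open>A = H \<inter> K\<close> and replace each by the coset \<open>t + K\<close>, using
  \<open>theta_ratio_mono\<close> for \<open>A\<close> inside \<open>K\<close>. The cosets
  \<open>t + K\<close> are disjoint and lie in \<open>G\<close>.\<close>

theorem theta_supermodular:
  fixes Q :: "'a::real_vector \<Rightarrow> real"
  assumes G: "add_subgroup G" and Q: "parallelogram_on G Q"
    and H: "add_subgroup H" and HG: "H \<subseteq> G" and K: "add_subgroup K" and KG: "K \<subseteq> G"
  shows "theta Q H 0 * theta Q K 0 \<le> theta Q G 0 * theta Q (H \<inter> K) 0"
proof -
  define A where "A = H \<inter> K"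
  have A: "add_subgroup A" unfolding A_def using H K by (rule add_subgroup_Int)
  obtain T where T: "T \<subseteq> H" "bij_betw (\<lambda>(t, a). t + a) (T \<times> A) H"
      "\<And>t t'. t \<in> T \<Longrightarrow> t' \<in> T \<Longrightarrow> t - t' \<in> A \<Longrightarrow> t = t'"
    using add_subgroup_transversal[OF A H] by (metis A_def inf_le1)
  \<comment> \<open>\<open>S\<close> is the sumset of \<open>H\<close> and \<open>K\<close>. Two
    representatives that agree modulo \<open>K\<close> differ by an element of both \<open>H\<close>
    and \<open>K\<close>, hence agree modulo \<open>A\<close> and are equal.\<close>
  define S where "S = (\<lambda>(t, a). t + a) ` (T \<times> K)"
  have bij: "bij_betw (\<lambda>(t, a). t + a) (T \<times> K) S"
    unfolding bij_betw_def S_def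
  proof (intro conjI refl inj_onI)
    fix p q assume p: "p \<in> T \<times> K" and q: "q \<in> T \<times> K"
      and eq: "(case p of (t, a) \<Rightarrow> t + a) = (case q of (t, a) \<Rightarrow> t + a)"
    then have "fst p - fst q = snd q - snd p" by (simp add: case_prod_unfold algebra_simps)
    moreover have "snd q - snd p \<in> K" "fst p - fst q \<in> H"
      using p q H K T(1) by (auto intro!: add_subgroup_diff)
    ultimately have "fst p = fst q" using T(3)[of "fst p" "fst q"] p q by (auto simp: A_def mem_Times_iff)
    with eq show "p = q" by (auto simp: case_prod_unfold prod_eq_iff)
  qed
  have SG: "S \<subseteq> G" using T(1) HG KG G by (auto simp: S_def intro!: add_subgroup_add)
  have "theta Q H 0 * theta Q K 0 = (\<integral>\<^sup>+t. theta Q A t * theta Q K 0 \<partial>count_space T)"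
    using theta_coset_sum[OF T(2), of Q 0] by (simp add: nn_integral_multc)
  also have "\<dots> \<le> (\<integral>\<^sup>+t. theta Q A 0 * theta Q K t \<partial>count_space T)"
    by (intro nn_integral_mono theta_ratio_mono[OF G Q A K _ KG]) (use T(1) HG in \<open>auto simp: A_def\<close>)
  also have "\<dots> = theta Q A 0 * theta Q S 0"
    using theta_coset_sum[OF bij, of Q 0] by (simp add: nn_integral_cmult)
  also have "\<dots> \<le> theta Q A 0 * theta Q G 0"
    unfolding theta_def by (intro mult_left_mono nn_integral_count_space_mono_set SG) simp
  finally show ?thesis by (simp add: A_def mult.commute)
qed

subsection \<open>Lattices\<close>

lemma group_closure_add_subgroup: "add_subgroup (group_closure S)"
  by (auto simp: add_subgroup_def intro: group_closure.diff)

lemma group_closure_superset: "S \<subseteq> group_closure S"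
  by (auto intro: group_closure.base)

lemma group_closure_least:
  assumes "add_subgroup H" "S \<subseteq> H"
  shows "group_closure S \<subseteq> H"
proof
  fix x assume "x \<in> group_closure S"
  then show "x \<in> H"
    by induction (use assms in \<open>auto intro: add_subgroup_closed\<close>)
qed

lemma group_closure_subset_span: "group_closure S \<subseteq> span S"
  by (rule group_closure_least)
     (auto simp: add_subgroup_def span_zero span_base intro: span_diff)

lemma add_subgroup_scale_int:
  fixes x :: "'a::real_vector"
  assumes A: "add_subgroup A" and x: "x \<in> A"
  shows "of_int k *\<^sub>R x \<in> A"
proof (induction k rule: int_induct[where k = 0])
  case base
  show ?case using A by (simp add: add_subgroup_zero)
next
  case (step1 i)
  then show ?case using add_subgroup_add[OF A _ x] by (simp add: scaleR_left_distrib)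
next
  case (step2 i)
  then show ?case using add_subgroup_diff[OF A _ x] by (simp add: scaleR_left_diff_distrib)
qed

lemma group_closure_insert_subset:
  fixes b :: "'a::real_vector"
  shows "group_closure (insert b S) \<subseteq> {y + of_int k *\<^sub>R b | y k. y \<in> group_closure S}"
    (is "_ \<subseteq> ?R")
proof (rule group_closure_least)
  show "add_subgroup ?R"
    unfolding add_subgroup_def
  proof (intro conjI ballI)
    have "0 = 0 + of_int 0 *\<^sub>R b" "0 \<in> group_closure S" by simp_all
    then show "0 \<in> ?R" by blast
    fix u v assume "u \<in> ?R" "v \<in> ?R"
    then obtain y k z l where "u = y + of_int k *\<^sub>R b" "y \<in> group_closure S"
        "v = z + of_int l *\<^sub>R b" "z \<in> group_closure S"
      by blast
    then have "u - v = (y - z) + of_int (k - l) *\<^sub>R b" "y - z \<in> group_closure S"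
      by (simp_all add: algebra_simps group_closure.diff)
    then show "u - v \<in> ?R" by blast
  qed
  have "b = 0 + of_int 1 *\<^sub>R b" by simp
  moreover have "s = s + of_int 0 *\<^sub>R b" for s by simp
  ultimately show "insert b S \<subseteq> ?R"
    using group_closure_superset[of S] zero_in_group_closure[of S] by blast
qed

text \<open>Induction on the basis, as for subgroups of free abelian groups of finite rank. Linear
  independence over the reals is carried along, since \<open>is_lattice\<close> demands it.\<close>

lemma subgroup_of_lattice:
  fixes B :: "'a::real_vector set"
  assumes "finite B" "independent B" "add_subgroup H" "H \<subseteq> group_closure B"
  shows "\<exists>C. independent C \<and> H = group_closure C"
  using assms
proof (induction B arbitrary: H rule: finite_induct)
  case empty
  then have "H = group_closure {}" using add_subgroup_zero by auto
  then show ?case using independent_empty by blast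
next
  case (insert b B)
  note H = \<open>add_subgroup H\<close>
  have B: "independent B" "b \<notin> span B"
    using insert.prems(1) insert.hyps(2) by (auto simp: independent_insert)
  obtain C where C: "independent C" "H \<inter> group_closure B = group_closure C"
    using insert.IH[OF B(1) add_subgroup_Int[OF H group_closure_add_subgroup]] by auto
  have CB: "C \<subseteq> span B"
    using group_closure_superset[of C] group_closure_subset_span[of B] C(2) by blast
  \<comment> \<open>The coefficients of \<open>b\<close> occurring in \<open>H\<close>. They form a
    subgroup of the integers, hence all multiples of some \<open>d\<close>, and \<open>h\<close>
    below is an element of \<open>H\<close> realizing \<open>d\<close>.\<close>
  define K where "K = {k::int. \<exists>y\<in>group_closure B. y + of_int k *\<^sub>R b \<in> H}"
  have K: "add_subgroup K"
    unfolding add_subgroup_def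
  proof (intro conjI ballI)
    show "0 \<in> K" using add_subgroup_zero[OF H] by (auto simp: K_def intro: bexI[of _ 0])
    fix k l assume "k \<in> K" "l \<in> K"
    then obtain y z where yz: "y \<in> group_closure B" "y + of_int k *\<^sub>R b \<in> H"
        "z \<in> group_closure B" "z + of_int l *\<^sub>R b \<in> H"
      by (auto simp: K_def)
    have "(y + of_int k *\<^sub>R b) - (z + of_int l *\<^sub>R b) = (y - z) + of_int (k - l) *\<^sub>R b"
      by (simp add: algebra_simps)
    then have "(y - z) + of_int (k - l) *\<^sub>R b \<in> H"
      using add_subgroup_diff[OF H yz(2,4)] by (simp only:)
    then show "k - l \<in> K"
      using yz unfolding K_def by (blast intro: group_closure.diff)
  qed
  have "group_closure K = K"
    using group_closure_least[OF K] group_closure_superset[of K] by blast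
  then obtain d where d: "K = range ((*) d)"
    using group_closure_eq[of K] by metis
  have "d \<in> K" unfolding d by (rule range_eqI[of _ _ 1]) simp
  then obtain y0 where y0: "y0 \<in> group_closure B" "y0 + of_int d *\<^sub>R b \<in> H"
    by (auto simp: K_def)
  define h where "h = y0 + of_int d *\<^sub>R b"
  \<comment> \<open>Subtracting a suitable multiple of \<open>h\<close> removes the \<open>b\<close>
    component and leaves an element of \<open>H \<inter> group_closure B\<close>, which
    \<open>C\<close> generates.\<close>
  have decomp: "\<exists>m c. c \<in> group_closure C \<and> x = c + of_int m *\<^sub>R h" if x: "x \<in> H" for x
  proof -
    obtain y k where yk: "x = y + of_int k *\<^sub>R b" "y \<in> group_closure B"
      using x insert.prems(3) group_closure_insert_subset[of b B] by blast
    then have "k \<in> K" using x by (auto simp: K_def)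
    then obtain m where m: "k = d * m" using d by auto
    have eq: "x - of_int m *\<^sub>R h = y - of_int m *\<^sub>R y0"
      by (simp add: yk m h_def algebra_simps)
    have "y - of_int m *\<^sub>R y0 \<in> group_closure B"
      by (intro group_closure.diff yk add_subgroup_scale_int group_closure_add_subgroup y0)
    moreover have "x - of_int m *\<^sub>R h \<in> H"
      using H x y0(2) by (auto simp: h_def intro!: add_subgroup_diff add_subgroup_scale_int)
    ultimately have "x - of_int m *\<^sub>R h \<in> group_closure C" using eq C(2) by auto
    then show ?thesis by (metis diff_add_cancel)
  qed
  show ?case
  proof (cases "d = 0")
    case True
    then have "h \<in> group_closure C" using y0 C(2) by (auto simp: h_def)
    then have "H \<subseteq> group_closure C"
      using decomp by (fastforce intro: group_closure_add add_subgroup_scale_int group_closure_add_subgroup)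
    then have "H = group_closure C" using C(2) by auto
    with C(1) show ?thesis by blast
  next
    case False
    have "h \<notin> span B"
    proof
      assume "h \<in> span B"
      then have "h - y0 \<in> span B" using y0(1) group_closure_subset_span[of B] by (blast intro: span_diff)
      then have "(1 / of_int d) *\<^sub>R (h - y0) \<in> span B" by (rule span_scale)
      then show False using B(2) False by (simp add: h_def)
    qed
    then have "h \<notin> span C" using CB span_minimal[OF CB subspace_span] by blast
    then have ind: "independent (insert h C)" using C(1) by (simp add: independent_insert)
    have "H \<subseteq> group_closure (insert h C)"
    proof
      fix x assume "x \<in> H"
      then obtain m c where mc: "c \<in> group_closure C" "x = c + of_int m *\<^sub>R h" using decomp by blast
      have "group_closure C \<subseteq> group_closure (insert h C)"
        by (rule group_closure_least[OF group_closure_add_subgroup]) (use group_closure_superset in blast)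
      moreover have "h \<in> group_closure (insert h C)" by (simp add: group_closure.base)
      ultimately show "x \<in> group_closure (insert h C)"
        using mc by (auto intro!: group_closure_add add_subgroup_scale_int group_closure_add_subgroup)
    qed
    moreover have "group_closure (insert h C) \<subseteq> H"
      by (rule group_closure_least[OF H]) (use y0 C(2) group_closure_superset[of C] in \<open>auto simp: h_def\<close>)
    ultimately show ?thesis using ind by blast
  qed
qed

lemma is_lattice_subgroup:
  assumes "is_lattice L" "add_subgroup H" "H \<subseteq> L"
  shows "is_lattice H"
  using assms subgroup_of_lattice independent_bound unfolding is_lattice_def by metis

lemma is_lattice_add_subgroup: "is_lattice L \<Longrightarrow> add_subgroup L"
  by (auto simp: is_lattice_def group_closure_add_subgroup)

section \<open>Summability of Gaussians on lattices\<close>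

lemma gaussian_summable_on_int:
  fixes c :: real
  assumes "0 < c"
  shows "(\<lambda>n::int. exp (- c * (of_int n)\<^sup>2)) summable_on UNIV"
proof -
  have nat: "(\<lambda>n::nat. exp (- c * (of_nat n)\<^sup>2)) summable_on UNIV"
  proof (rule summable_on_comparison_test)
    have "summable (\<lambda>n. exp (- c) ^ n)" using assms by (intro summable_geometric) simp
    then show "(\<lambda>n. exp (- c) ^ n) summable_on UNIV"
      by (intro norm_summable_imp_summable_on) simp
    fix n :: nat
    \<comment> \<open>Since n is at most its square, a geometric series dominates; the negative
      integers follow by reflection.\<close>
    have "real n \<le> (real n)\<^sup>2" by (cases n) (auto simp: power2_eq_square)
    then have "c * real n \<le> c * (real n)\<^sup>2" using assms by simp
    then show "exp (- c * (of_nat n)\<^sup>2) \<le> exp (- c) ^ n"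
      by (simp add: exp_of_nat_mult[symmetric] mult.commute)
  qed auto
  have "(\<lambda>n::int. exp (- c * (of_int n)\<^sup>2)) summable_on range int"
    by (subst summable_on_reindex) (use nat in \<open>auto simp: o_def\<close>)
  moreover have "(\<lambda>n::int. exp (- c * (of_int n)\<^sup>2)) summable_on range (\<lambda>n. - int n)"
    by (subst summable_on_reindex) (use nat in \<open>auto simp: o_def inj_on_def\<close>)
  ultimately have "(\<lambda>n::int. exp (- c * (of_int n)\<^sup>2)) summable_on (range int \<union> range (\<lambda>n. - int n))"
    by (intro summable_on_union)
  moreover have "range int \<union> range (\<lambda>n. - int n) = UNIV"
    by (auto intro: int_cases2)
  ultimately show ?thesis by simp
qed

text \<open>In basis coordinates a lattice vector is an integer vector, and the squared norm bounds
  the sum of squared coordinates up to the constant \<open>D\<close>. The Gaussian is therefore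
  dominated by a finite product of one-dimensional Gaussians.\<close>

lemma gaussian_summable_on_lattice:
  fixes L :: "'a::euclidean_space set"
  assumes L: "is_lattice L" and c: "0 < c"
  shows "(\<lambda>x. exp (- c * (norm x)\<^sup>2)) summable_on L"
proof -
  obtain B where B: "independent B" "L = group_closure B" using L by (auto simp: is_lattice_def)
  have fin: "finite B" using B(1) independent_bound by auto
  have "\<exists>\<phi>. linear \<phi> \<and> (\<forall>x\<in>B. \<phi> x = (if x = b then 1 else 0 :: real))" for b
    using linear_independent_extend[OF B(1)] .
  then obtain \<phi> where lin: "\<And>b. linear (\<phi> b :: 'a \<Rightarrow> real)"
      and \<phi>: "\<And>b x. x \<in> B \<Longrightarrow> \<phi> b x = (if x = b then 1 else 0)"
    by metis
  \<comment> \<open>Vectors that have integer coordinates and are recovered from them.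
    \<open>R\<close> is a subgroup containing \<open>B\<close>, so it contains all of
    \<open>L\<close>.\<close>
  define R where "R = {x. (\<Sum>b\<in>B. \<phi> b x *\<^sub>R b) = x \<and> (\<forall>b. \<phi> b x \<in> \<int>)}"
  have "add_subgroup R"
    unfolding add_subgroup_def R_def
    by (auto simp: linear_0[OF lin] linear_diff[OF lin] scaleR_left_diff_distrib sum_subtractf)
  moreover have "B \<subseteq> R"
    using fin by (auto simp: R_def \<phi> if_distrib[of "\<lambda>r. r *\<^sub>R _"] sum.delta cong: if_cong)
  ultimately have LR: "L \<subseteq> R" unfolding B(2) by (rule group_closure_least)
  have "\<exists>K>0. \<forall>x. norm (\<phi> b x) \<le> K * norm x" for b
    using linear_bounded_pos[OF lin] by metis
  then obtain K where K: "\<And>b x. norm (\<phi> b x) \<le> K b * norm x" "\<And>b. K b > 0"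
    by metis
  \<comment> \<open>The summand 1 keeps \<open>D\<close> positive when \<open>B\<close> is
    empty.\<close>
  define D where "D = 1 + (\<Sum>b\<in>B. (K b)\<^sup>2)"
  have D: "D > 0" unfolding D_def by (intro add_pos_nonneg sum_nonneg) auto
  have norm_lower: "(\<Sum>b\<in>B. (\<phi> b x)\<^sup>2) \<le> D * (norm x)\<^sup>2" for x
  proof -
    have "(\<phi> b x)\<^sup>2 \<le> (K b)\<^sup>2 * (norm x)\<^sup>2" for b
      using power_mono[OF K(1)[of b x], of 2] by (simp add: power_mult_distrib)
    then have "(\<Sum>b\<in>B. (\<phi> b x)\<^sup>2) \<le> (\<Sum>b\<in>B. (K b)\<^sup>2) * (norm x)\<^sup>2"
      unfolding sum_distrib_right by (intro sum_mono)
    also have "\<dots> \<le> D * (norm x)\<^sup>2" unfolding D_def by (simp add: distrib_right)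
    finally show ?thesis .
  qed
  define e where "e = c / D"
  have e: "e > 0" using c D by (simp add: e_def)
  define P where "P g = (\<Prod>b\<in>B. exp (- e * (of_int (g b))\<^sup>2))" for g :: "'a \<Rightarrow> int"
  have "Infinite_Sum.abs_summable_on P (PiE B (\<lambda>_. UNIV))"
    unfolding P_def abs_summable_equivalent
    by (rule abs_summable_on_prod_PiE[OF fin])
       (use gaussian_summable_on_int[OF e] in \<open>auto simp flip: abs_summable_equivalent\<close>)
  moreover have "norm (P g) = P g" for g
    by (simp add: P_def prod_nonneg)
  ultimately have sP: "P summable_on PiE B (\<lambda>_. UNIV)" by simp
  \<comment> \<open>The floor only changes the type, as coordinates on \<open>L\<close> are integers
    already; restriction to \<open>B\<close> puts the values into \<open>PiE\<close>.\<close>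
  define \<psi> where "\<psi> x = (\<lambda>b\<in>B. \<lfloor>\<phi> b x\<rfloor>)" for x
  have of_int_\<psi>: "of_int (\<psi> x b) = \<phi> b x" if "x \<in> L" "b \<in> B" for x b
    using that LR by (auto simp: \<psi>_def R_def elim!: Ints_cases)
  have inj: "inj_on \<psi> L"
  proof (rule inj_onI)
    fix x y assume x: "x \<in> L" and y: "y \<in> L" and eq: "\<psi> x = \<psi> y"
    have "\<phi> b x = \<phi> b y" if "b \<in> B" for b
      using of_int_\<psi>[OF x that] of_int_\<psi>[OF y that] eq by simp
    then have "(\<Sum>b\<in>B. \<phi> b x *\<^sub>R b) = (\<Sum>b\<in>B. \<phi> b y *\<^sub>R b)" by simp
    moreover have "(\<Sum>b\<in>B. \<phi> b z *\<^sub>R b) = z" if "z \<in> L" for z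
      using that LR by (auto simp: R_def)
    ultimately show "x = y" using x y by metis
  qed
  have "P summable_on \<psi> ` L"
    by (rule summable_on_subset_banach[OF sP]) (auto simp: \<psi>_def)
  then have "(P \<circ> \<psi>) summable_on L" by (simp add: summable_on_reindex[OF inj])
  then show ?thesis
  proof (rule summable_on_comparison_test)
    fix x assume x: "x \<in> L"
    have "e * (\<Sum>b\<in>B. (\<phi> b x)\<^sup>2) \<le> c * (norm x)\<^sup>2"
      using mult_left_mono[OF norm_lower[of x], of e] e D by (simp add: e_def field_simps)
    moreover have "(P \<circ> \<psi>) x = exp (- (e * (\<Sum>b\<in>B. (\<phi> b x)\<^sup>2)))"
      using fin by (simp add: P_def of_int_\<psi>[OF x] exp_sum[symmetric] sum_negf sum_distrib_left)
    ultimately show "exp (- c * (norm x)\<^sup>2) \<le> (P \<circ> \<psi>) x" by simp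
  qed simp
qed

subsection \<open>Lattice homomorphisms\<close>

text \<open>The bridge from \<open>ennreal\<close> sums to the real sums in \<open>rho\<close>.
  Summability excludes the case where the left side is infinite and \<open>infsum\<close> takes its
  default value 0.\<close>

lemma nn_integral_count_space_eq_infsum:
  fixes f :: "'a \<Rightarrow> real"
  assumes f: "f summable_on A" and nonneg: "\<And>x. x \<in> A \<Longrightarrow> 0 \<le> f x"
  shows "(\<integral>\<^sup>+x. ennreal (f x) \<partial>count_space A) = ennreal (infsum f A)"
proof -
  have "Infinite_Sum.abs_summable_on f A"
    using f by (rule summable_on_cong[THEN iffD1, rotated]) (simp add: nonneg)
  then have "Infinite_Set_Sum.abs_summable_on f A" by (rule abs_summable_equivalent[THEN iffD1])
  then show ?thesis using nonneg by (simp add: nn_integral_conv_infsetsum infsetsum_infsum)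
qed

lemma gauss_summable_on_lattice: "is_lattice L \<Longrightarrow> gauss summable_on L"
  unfolding gauss_def[abs_def] by (intro gaussian_summable_on_lattice pi_gt_zero)

lemma nn_integral_gauss: "is_lattice L \<Longrightarrow> (\<integral>\<^sup>+x. ennreal (gauss x) \<partial>count_space L) = ennreal (rho L)"
  unfolding rho_def
  by (intro nn_integral_count_space_eq_infsum gauss_summable_on_lattice) (simp_all add: gauss_def)

lemma rho_mono:
  assumes "is_lattice L" "K \<subseteq> L"
  shows "rho K \<le> rho L"
  unfolding rho_def using assms gauss_summable_on_lattice[OF assms(1)]
  by (intro infsum_mono_neutral) (auto simp: gauss_def intro: summable_on_subset_banach)

lemma rho_zero [simp]: "rho {0} = 1"
  by (simp add: rho_def gauss_def)

text \<open>The origin alone contributes 1. The resulting positivity is what makes the logarithms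
  and divisions by masses meaningful.\<close>

lemma rho_ge_1: "is_lattice L \<Longrightarrow> 1 \<le> rho L"
  using rho_mono[of L "{0}"] is_lattice_add_subgroup[of L] by (simp add: add_subgroup_zero)

lemma lattice_hom_zero:
  assumes "lattice_hom L M f" shows "f 0 = 0"
proof -
  have "0 \<in> L" using assms by (simp add: lattice_hom_def is_lattice_add_subgroup add_subgroup_zero)
  then have "f (0 + 0) = f 0 + f 0" using assms unfolding lattice_hom_def by blast
  then show ?thesis by simp
qed

lemma lattice_hom_diff:
  assumes f: "lattice_hom L M f" and x: "x \<in> L" and y: "y \<in> L"
  shows "f (x - y) = f x - f y"
proof -
  have "x - y \<in> L" using assms by (simp add: lattice_hom_def is_lattice_add_subgroup add_subgroup_diff)
  then have "f ((x - y) + y) = f (x - y) + f y" using f y unfolding lattice_hom_def by blast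
  then show ?thesis by simp
qed

lemma add_subgroup_lattice_hom_preimage:
  assumes f: "lattice_hom L M f" and K: "add_subgroup K"
  shows "add_subgroup {x \<in> L. f x \<in> K}"
  using assms is_lattice_add_subgroup[of L]
  by (auto simp: add_subgroup_def lattice_hom_zero lattice_hom_diff[OF f] lattice_hom_def)

lemma lattice_ker_conv_preimage: "lattice_ker L f = {x \<in> L. f x \<in> {0}}"
  by (simp add: lattice_ker_def)

lemma is_lattice_ker: "lattice_hom L M f \<Longrightarrow> is_lattice (lattice_ker L f)"
  unfolding lattice_ker_conv_preimage
  by (rule is_lattice_subgroup[OF _ add_subgroup_lattice_hom_preimage])
     (auto simp: lattice_hom_def add_subgroup_def)

text \<open>Both product subgroups \<open>G\<close> and \<open>N\<close> have the factor
  \<open>\<omega>\<close> in their mass, and it cancels in the supermodular inequality. This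
  requires \<open>\<omega>\<close> to be finite, which is the purpose of \<open>e\<close>: for
  \<open>e = 0\<close> the form \<open>q\<close> vanishes identically when \<open>f\<close> is an
  isometry.\<close>

lemma rho_preimage_perturbed:
  fixes f :: "'a::euclidean_space \<Rightarrow> 'b::euclidean_space"
  assumes f: "lattice_hom L M f" and K: "is_lattice K" "K \<subseteq> M" and e: "0 < e"
  shows "(\<Sum>\<^sub>\<infinity>x\<in>L. exp (- (pi * (1 + e)) * (norm x)\<^sup>2)) * rho K \<le> rho M * rho {x \<in> L. f x \<in> K}"
proof -
  have L: "is_lattice L" "add_subgroup L" and M: "is_lattice M" "add_subgroup M"
    and fM: "\<And>x. x \<in> L \<Longrightarrow> f x \<in> M" and fle: "\<And>x. x \<in> L \<Longrightarrow> norm (f x) \<le> norm x"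
    using f by (auto simp: lattice_hom_def is_lattice_add_subgroup)
  define L' where "L' = {x \<in> L. f x \<in> K}"
  have L'sub: "add_subgroup L'" unfolding L'_def
    by (rule add_subgroup_lattice_hom_preimage[OF f is_lattice_add_subgroup[OF K(1)]])
  have L': "is_lattice L'"
    by (rule is_lattice_subgroup[OF L(1) L'sub]) (auto simp: L'_def)
  define q where "q x = pi * ((1 + e) * (norm x)\<^sup>2 - (norm (f x))\<^sup>2)" for x
  define Q where "Q = (\<lambda>(m :: 'b, x :: 'a). pi * (norm m)\<^sup>2 + q x)"
  define G where "G = M \<times> L"
  define H where "H = (\<lambda>x. (f x, x)) ` L"
  define N where "N = K \<times> L"
  define \<omega> where "\<omega> = (\<integral>\<^sup>+x. ennreal (exp (- q x)) \<partial>count_space L)"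
  have Times: "add_subgroup (A \<times> B)" if "add_subgroup A" "add_subgroup B" for A :: "'b set" and B :: "'a set"
    using that by (auto simp: add_subgroup_def zero_prod_def)
  have G: "add_subgroup G" and N: "add_subgroup N"
    unfolding G_def N_def by (intro Times L M is_lattice_add_subgroup[OF K(1)])+
  have H: "add_subgroup H"
    unfolding add_subgroup_def
  proof (intro conjI ballI)
    show "0 \<in> H" using add_subgroup_zero[OF L(2)] lattice_hom_zero[OF f]
      by (auto simp: H_def zero_prod_def intro!: image_eqI[of _ _ 0])
    fix u v assume "u \<in> H" "v \<in> H"
    then obtain x y where "x \<in> L" "y \<in> L" "u = (f x, x)" "v = (f y, y)" by (auto simp: H_def)
    then show "u - v \<in> H" unfolding H_def
      by (intro image_eqI[of _ _ "x - y"]) (auto simp: lattice_hom_diff[OF f] add_subgroup_diff[OF L(2)])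
  qed
  have norm_par: "(norm (u + v))\<^sup>2 + (norm (u - v))\<^sup>2 = 2 * (norm u)\<^sup>2 + 2 * (norm v)\<^sup>2"
    for u v :: "'c::real_inner"
    by (simp add: power2_norm_eq_inner inner_simps inner_commute)
  \<comment> \<open>The parallelogram law for \<open>Q\<close> as a combination of those for
    \<open>m\<close>, \<open>x\<close> and \<open>f x\<close>, with weights \<open>pi\<close>,
    \<open>pi * (1 + e)\<close> and \<open>- pi\<close>.\<close>
  have comb: "pi * a + pi * ((1 + e) * b - c) + (pi * a' + pi * ((1 + e) * b' - c'))
      = 2 * (pi * m + pi * ((1 + e) * x - u)) + 2 * (pi * n + pi * ((1 + e) * y - v))"
    if "a + a' = 2 * m + 2 * n" "b + b' = 2 * x + 2 * y" "c + c' = 2 * u + 2 * v"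
    for a a' b b' c c' m n x y u v :: real
  proof -
    have sub: "a = 2 * m + 2 * n - a'" "b = 2 * x + 2 * y - b'" "c = 2 * u + 2 * v - c'"
      using that by simp_all
    show ?thesis unfolding sub by (simp add: algebra_simps)
  qed
  have Q: "parallelogram_on G Q"
    unfolding parallelogram_on_def
  proof (intro ballI)
    fix u v assume "u \<in> G" "v \<in> G"
    then obtain m x n y where uv: "u = (m, x)" "v = (n, y)" "x \<in> L" "y \<in> L" by (auto simp: G_def)
    have "f (x + y) = f x + f y" using f uv unfolding lattice_hom_def by blast
    then show "Q (u + v) + Q (u - v) = 2 * Q u + 2 * Q v"
      using comb[OF norm_par[of m n] norm_par[of x y] norm_par[of "f x" "f y"]]
      unfolding uv Q_def q_def by (simp add: lattice_hom_diff[OF f uv(3,4)])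
  qed
  \<comment> \<open>On the graph the terms in \<open>f x\<close> cancel and \<open>Q\<close> reduces
    to a multiple of the squared norm of \<open>x\<close>.\<close>
  have graph: "(\<integral>\<^sup>+z. ennreal (exp (- Q z)) \<partial>count_space ((\<lambda>x. (f x, x)) ` S))
      = (\<integral>\<^sup>+x. ennreal (exp (- (pi * (1 + e)) * (norm x)\<^sup>2)) \<partial>count_space S)" for S
  proof -
    have "bij_betw (\<lambda>x. (f x, x)) S ((\<lambda>x. (f x, x)) ` S)" by (auto simp: bij_betw_def inj_on_def)
    from nn_integral_bij_count_space[OF this, symmetric] show ?thesis
      by (simp add: Q_def q_def algebra_simps)
  qed
  have prod: "(\<integral>\<^sup>+z. ennreal (exp (- Q z))
      \<partial>count_space (S \<times> L)) = ennreal (rho S) * \<omega>"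
    if "is_lattice S" for S
  proof -
    have "ennreal (exp (- Q z)) = (case z of (m, x) \<Rightarrow> ennreal (gauss m) * ennreal (exp (- q x)))" for z
      by (cases z) (simp add: Q_def gauss_def ennreal_mult'[symmetric] mult_exp_exp)
    then show ?thesis
      by (simp add: \<omega>_def nn_integral_gauss[OF that, symmetric] nn_integral_count_space_product)
  qed
  have summable: "(\<lambda>x. exp (- (pi * (1 + e)) * (norm x)\<^sup>2)) summable_on L"
    using e by (intro gaussian_summable_on_lattice L) simp
  have HN: "H \<inter> N = (\<lambda>x. (f x, x)) ` L'" by (auto simp: H_def N_def L'_def)
  have tH: "theta Q H 0 = ennreal (\<Sum>\<^sub>\<infinity>x\<in>L. exp (- (pi * (1 + e)) * (norm x)\<^sup>2))"
    unfolding theta_def add_0_right H_def graph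
    by (rule nn_integral_count_space_eq_infsum[OF summable]) (rule exp_ge_zero)
  have tN: "theta Q N 0 = ennreal (rho K) * \<omega>" and tG: "theta Q G 0 = ennreal (rho M) * \<omega>"
    unfolding theta_def add_0_right N_def G_def by (rule prod, fact)+
  have "exp (- (pi * (1 + e)) * (norm x)\<^sup>2) \<le> gauss x" for x :: 'a
    using e by (simp add: gauss_def distrib_left left_diff_distrib)
  then have tHN: "theta Q (H \<inter> N) 0 \<le> ennreal (rho L')"
    unfolding theta_def add_0_right HN graph nn_integral_gauss[OF L', symmetric]
    by (intro nn_integral_mono ennreal_leI)
  have "theta Q H 0 * theta Q N 0 \<le> theta Q G 0 * theta Q (H \<inter> N) 0"
    by (rule theta_supermodular[OF G Q H _ N]) (use fM K(2) in \<open>auto simp: H_def N_def G_def\<close>)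
  also have "\<dots> \<le> theta Q G 0 * ennreal (rho L')"
    by (rule mult_left_mono[OF tHN]) simp
  finally have le: "\<omega> * (ennreal (\<Sum>\<^sub>\<infinity>x\<in>L. exp (- (pi * (1 + e)) * (norm x)\<^sup>2)) * ennreal (rho K))
      \<le> \<omega> * (ennreal (rho M) * ennreal (rho L'))"
    unfolding tH tN tG by (simp only: mult_ac)
  \<comment> \<open>Here the norm bound on \<open>f\<close> enters: \<open>\<omega>\<close> is
    dominated by a convergent Gaussian sum with parameter \<open>pi * e\<close>.\<close>
  have "q x \<ge> (pi * e) * (norm x)\<^sup>2" if "x \<in> L" for x
    using power_mono[OF fle[OF that], of 2] by (simp add: q_def algebra_simps)
  then have "\<omega> \<le> (\<integral>\<^sup>+x. ennreal (exp (- (pi * e) * (norm x)\<^sup>2)) \<partial>count_space L)"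
    unfolding \<omega>_def by (intro nn_integral_mono ennreal_leI) simp
  also have "\<dots> = ennreal (\<Sum>\<^sub>\<infinity>x\<in>L. exp (- (pi * e) * (norm x)\<^sup>2))"
    using e by (intro nn_integral_count_space_eq_infsum gaussian_summable_on_lattice L) simp_all
  also have "\<dots> < top" by simp
  finally have fin: "\<omega> < top" .
  have "ennreal (exp (- q 0)) \<le> \<omega>"
    using nn_integral_count_space_mono_set[of "{0}" L "\<lambda>x. ennreal (exp (- q x))"] add_subgroup_zero[OF L(2)]
    by (simp add: \<omega>_def nn_integral_count_space_finite)
  then have pos: "0 < \<omega>" by (rule less_le_trans[rotated]) simp
  have "ennreal (\<Sum>\<^sub>\<infinity>x\<in>L. exp (- (pi * (1 + e)) * (norm x)\<^sup>2)) * ennreal (rho K)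
      \<le> ennreal (rho M) * ennreal (rho L')"
    using le fin pos by (simp add: ennreal_mult_le_mult_iff)
  moreover have "0 \<le> rho M" "0 \<le> rho K" "0 \<le> rho L'"
    using rho_ge_1[OF M(1)] rho_ge_1[OF K(1)] rho_ge_1[OF L'] by simp_all
  ultimately show ?thesis
    by (simp add: L'_def infsum_nonneg flip: ennreal_mult)
qed

text \<open>The limit as \<open>e\<close> tends to 0 is taken in finite partial sums, where
  continuity suffices; the bound, being uniform in the finite set, passes to the infinite
  sum.\<close>

lemma rho_preimage:
  assumes f: "lattice_hom L M f" and K: "is_lattice K" "K \<subseteq> M"
  shows "rho L * rho K \<le> rho M * rho {x \<in> L. f x \<in> K}"
proof -
  let ?C = "rho M * rho {x \<in> L. f x \<in> K}"
  have L: "is_lattice L" using f by (simp add: lattice_hom_def)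
  have K0: "rho K > 0" using rho_ge_1[OF K(1)] by simp
  have "rho L \<le> ?C / rho K"
    unfolding rho_def[of L]
  proof (rule infsum_le_finite_sums[OF gauss_summable_on_lattice[OF L]])
    fix F assume F: "finite F" "F \<subseteq> L"
    have "(\<Sum>x\<in>F. exp (- (pi * (1 + e)) * (norm x)\<^sup>2)) \<le> ?C / rho K" if e: "e > 0" for e :: real
    proof -
      have "(\<Sum>x\<in>F. exp (- (pi * (1 + e)) * (norm x)\<^sup>2)) \<le> (\<Sum>\<^sub>\<infinity>x\<in>L. exp (- (pi * (1 + e)) * (norm x)\<^sup>2))"
        using e F by (intro finite_sum_le_infsum gaussian_summable_on_lattice L) simp_all
      also have "\<dots> \<le> ?C / rho K"
        using rho_preimage_perturbed[OF f K e] K0 by (simp add: field_simps)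
      finally show ?thesis .
    qed
    then have "eventually (\<lambda>e. (\<Sum>x\<in>F. exp (- (pi * (1 + e)) * (norm x)\<^sup>2)) \<le> ?C / rho K) (at_right (0::real))"
      by (auto simp: eventually_at_right_field intro: exI[of _ 1])
    moreover have "((\<lambda>e. \<Sum>x\<in>F. exp (- (pi * (1 + e)) * (norm x)\<^sup>2))
        \<longlongrightarrow> (\<Sum>x\<in>F. exp (- (pi * (1 + 0)) * (norm x)\<^sup>2))) (at_right (0::real))"
      by (intro tendsto_intros)
    ultimately have "(\<Sum>x\<in>F. exp (- (pi * (1 + 0)) * (norm x)\<^sup>2)) \<le> ?C / rho K"
      using tendsto_upperbound trivial_limit_at_right_real by blast
    then show "sum gauss F \<le> ?C / rho K" by (simp add: gauss_def)
  qed
  then show ?thesis using K0 by (simp add: field_simps)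
qed

section \<open>Properties of the rank\<close>

lemma rk_eq_ln:
  assumes "lattice_hom L M f"
  shows "rk L f = ln (rho L / rho (lattice_ker L f))"
  using rho_ge_1[of L] rho_ge_1[OF is_lattice_ker[OF assms]] assms
  by (simp add: rk_def ell_def ln_div lattice_hom_def)

lemma rk_nonneg:
  assumes f: "lattice_hom L M f"
  shows "0 \<le> rk L f"
  unfolding rk_eq_ln[OF f]
  using rho_ge_1[OF is_lattice_ker[OF f]] f
  by (intro ln_ge_zero) (simp add: rho_mono lattice_hom_def lattice_ker_def)

lemma lattice_hom_comp:
  assumes "lattice_hom L M f" "lattice_hom M N g"
  shows "lattice_hom L N (g \<circ> f)"
  using assms unfolding lattice_hom_def by simp (meson order_trans)

text \<open>Composing with \<open>g\<close> can only enlarge the kernel, and mass is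
  monotone.\<close>

lemma rk_comp_le_inner:
  assumes f: "lattice_hom L M f" and g: "lattice_hom M N g"
  shows "rk L (g \<circ> f) \<le> rk L f"
proof -
  note gf = lattice_hom_comp[OF f g]
  have "lattice_ker L f \<subseteq> lattice_ker L (g \<circ> f)"
    using lattice_hom_zero[OF g] by (auto simp: lattice_ker_def)
  then have "rho (lattice_ker L f) \<le> rho (lattice_ker L (g \<circ> f))"
    by (rule rho_mono[OF is_lattice_ker[OF gf]])
  then show ?thesis
    using rho_ge_1[OF is_lattice_ker[OF f]] by (simp add: rk_def ell_def)
qed

text \<open>The kernel of \<open>g \<circ> f\<close> is the preimage of the kernel of
  \<open>g\<close>, so \<open>rho_preimage\<close> compares the two mass ratios.\<close>

lemma rk_comp_le_outer:
  assumes f: "lattice_hom L M f" and g: "lattice_hom M N g"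
  shows "rk L (g \<circ> f) \<le> rk M g"
proof -
  note gf = lattice_hom_comp[OF f g]
  have ker: "{x \<in> L. f x \<in> lattice_ker M g} = lattice_ker L (g \<circ> f)"
    using f by (auto simp: lattice_ker_def lattice_hom_def)
  have "rho L * rho (lattice_ker M g) \<le> rho M * rho (lattice_ker L (g \<circ> f))"
    using rho_preimage[OF f is_lattice_ker[OF g]] unfolding ker by (auto simp: lattice_ker_def)
  moreover have "rho L \<ge> 1" "rho M \<ge> 1" "rho (lattice_ker M g) \<ge> 1" "rho (lattice_ker L (g \<circ> f)) \<ge> 1"
    using f is_lattice_ker[OF g] is_lattice_ker[OF gf] by (auto simp: lattice_hom_def intro!: rho_ge_1)
  ultimately show ?thesis
    unfolding rk_eq_ln[OF gf] rk_eq_ln[OF g] by (intro ln_mono) (simp_all add: field_simps)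
qed

lemma rk_id:
  assumes "is_lattice L"
  shows "rk L id = ell L"
proof -
  have "lattice_ker L id = {0}"
    using add_subgroup_zero[OF is_lattice_add_subgroup[OF assms]] by (auto simp: lattice_ker_def)
  then show ?thesis by (simp add: rk_def ell_def)
qed

theorem corollary8p6:
  shows
    "(\<forall>(L::'a::euclidean_space set) (M::'b::euclidean_space set) f.
        lattice_hom L M f \<longrightarrow> gauss summable_on L \<and> 0 \<le> rk L f) \<and>
     (\<forall>(L::'a set) (M::'b set) (N::'c::euclidean_space set) f g.
        lattice_hom L M f \<longrightarrow> lattice_hom M N g \<longrightarrow>
          rk L (g \<circ> f) \<le> rk L f \<and> rk L (g \<circ> f) \<le> rk M g) \<and>
     (\<forall>(L::'a set) (M::'b set) f.
        lattice_hom L M f \<longrightarrow>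
          is_lattice (lattice_ker L f) \<and>
          rk L f = rk L (id :: 'a \<Rightarrow> 'a) - rk (lattice_ker L f) (id :: 'a \<Rightarrow> 'a))"
proof (intro conjI allI impI)
  fix L :: "'a set" and M :: "'b set" and f assume f: "lattice_hom L M f"
  then have L: "is_lattice L" by (simp add: lattice_hom_def)
  show "gauss summable_on L" using L by (rule gauss_summable_on_lattice)
  show "0 \<le> rk L f" using f by (rule rk_nonneg)
  show ker: "is_lattice (lattice_ker L f)" using f by (rule is_lattice_ker)
  show "rk L f = rk L id - rk (lattice_ker L f) id"
    \<comment> \<open>An identity map has kernel \<open>{0}\<close> of mass 1, so its rank is
      \<open>ell\<close> of the lattice and the claim becomes the definition of
      \<open>rk\<close>.\<close>
    by (simp add: rk_id L ker) (simp add: rk_def)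
next
  fix L :: "'a set" and M :: "'b set" and N :: "'c set" and f g
  assume "lattice_hom L M f" "lattice_hom M N g"
  then show "rk L (g \<circ> f) \<le> rk L f" "rk L (g \<circ> f) \<le> rk M g"
    by (rule rk_comp_le_inner, rule rk_comp_le_outer)
qed

end
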